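(* Let $n$ be a positive integer with $n \equiv 2$ or $3 \pmod 4$. There are no continuous inverse ambiguous functions on the special orthogonal group $SO(n)$.
   Context: For a group $G$, a function $f : G \to G$ is called inverse ambiguous if it is bijective and its inverse function satisfies $f^{-1}(x) = (f(x))^{-1}$ for all $x \in G$, where the right-hand side is the group inverse of $f(x)$. Equivalently, $f(f(x)) = x^{-1}$ for all $x \in G$. $SO(n)$ is the multiplicative group of real $n \times n$ matrices $A$ with $AA^T = I_n$ and $\det A = 1$, with the subspace topology from the space of real $n \times n$ matrices. *)

theory Defs
  imports "HOL-Analysis.Analysis" "HOL-Algebra.Group"
begin

text \<open>Functions on a group are represented by total functions on the ambient type; only their
  values on the carrier matter.\<close>

definition inverse_ambiguous :: "('a, 'b) monoid_scheme \<Rightarrow> ('a \<Rightarrow> 'a) \<Rightarrow> bool"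
  where "inverse_ambiguous G f \<longleftrightarrow>
    bij_betw f (carrier G) (carrier G) \<and>
    (\<forall>x\<in>carrier G. inv_into (carrier G) f x = inv\<^bsub>G\<^esub> (f x))"

definition SO :: "(real^'n^'n) monoid"
  where "SO = \<lparr>carrier = {A. A ** transpose A = mat 1 \<and> det A = 1},
               monoid.mult = (**), one = mat 1\<rparr>"

lemma SO_simps:
  "carrier (SO :: (real^'n^'n) monoid) = {A. A ** transpose A = mat 1 \<and> det A = 1}"
  "A \<otimes>\<^bsub>SO\<^esub> B = A ** B"
  "\<one>\<^bsub>SO\<^esub> = mat 1"
  by (simp_all add: SO_def)

lemma transpose_in_SO:
  fixes A :: "real^'n^'n"
  assumes "A \<in> carrier SO"
  shows "transpose A \<in> carrier SO" "transpose A ** A = mat 1"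
proof -
  show *: "transpose A ** A = mat 1"
    using assms by (simp add: SO_simps matrix_left_right_inverse)
  show "transpose A \<in> carrier SO"
    using assms * by (simp add: SO_simps det_transpose transpose_transpose)
qed

lemma group_SO: "group (SO :: (real^'n^'n) monoid)"
proof (rule groupI)
  fix A B :: "real^'n^'n"
  assume AB: "A \<in> carrier SO" "B \<in> carrier SO"
  have "(A ** B) ** transpose (A ** B) = A ** (B ** transpose B) ** transpose A"
    by (simp add: matrix_transpose_mul matrix_mul_assoc)
  then show "A \<otimes>\<^bsub>SO\<^esub> B \<in> carrier SO"
    using AB by (simp add: SO_simps det_mul)
next
  fix A :: "real^'n^'n"
  assume "A \<in> carrier SO"
  then show "\<exists>B\<in>carrier SO. B \<otimes>\<^bsub>SO\<^esub> A = \<one>\<^bsub>SO\<^esub>"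
    using transpose_in_SO by (metis SO_simps(2,3))
qed (simp_all add: SO_simps transpose_mat matrix_mul_assoc)

lemma inv_SO:
  fixes A :: "real^'n^'n"
  assumes "A \<in> carrier SO"
  shows "inv\<^bsub>SO\<^esub> A = transpose A"
  by (rule group.inv_equality[OF group_SO])
     (use assms transpose_in_SO[OF assms] in \<open>simp_all add: SO_simps(2,3)\<close>)

end

theory Submission
  imports Defs "HOL-Homology.Homology"
begin

text \<open>An inverse ambiguous \<open>f\<close> is a homeomorphism of \<open>SO(n)\<close> whose square is the inversion.
  Inversion acts as \<open>- 1\<close> on the space of skew-symmetric matrices, the tangent space at the
  identity; its dimension \<open>n (n - 1) / 2\<close> is odd, so the local degree of inversion is \<open>- 1\<close>.
  In the Cayley chart translated to a point \<open>x\<close> and to \<open>f x\<close>, the map \<open>f\<close> has a local degree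
  that is constant along a path from the identity to \<open>f 1\<close>. Hence the local degree of
  \<open>f \<circ> f\<close> at the identity is a square, which \<open>- 1\<close> is not.\<close>


section \<open>Degrees of signed coordinate permutations of the sphere\<close>

text \<open>Covers the coordinate swaps and the sign changes used below: neither alters the sum of
  squares, and indices beyond \<open>p\<close> are fixed by \<open>\<pi>\<close>.\<close>

lemma continuous_map_nsphere_sign_permute:
  fixes c :: "nat \<Rightarrow> real"
  assumes "\<pi> permutes {..p}" "\<And>i. (c i)\<^sup>2 = 1"
  shows "continuous_map (nsphere p) (nsphere p) (\<lambda>x i. c i * x (\<pi> i))"
proof -
  have "(\<Sum>i\<le>p. (c i * x (\<pi> i))\<^sup>2) = (\<Sum>i\<le>p. (x i)\<^sup>2)" for x :: "nat \<Rightarrow> real"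
    using sum.permute[OF assms(1), of "\<lambda>i. (x i)\<^sup>2"] assms(2)
    by (simp add: power_mult_distrib o_def)
  moreover have "x (\<pi> i) = 0" if "\<forall>i>p. x i = 0" "i > p" for x :: "nat \<Rightarrow> real" and i
    using that assms(1) by (simp add: permutes_def)
  moreover have "continuous_map (powertop_real UNIV) (powertop_real UNIV)
      (\<lambda>x i. c i * x (\<pi> i))"
    unfolding continuous_map_componentwise_UNIV
    by (intro allI continuous_intros continuous_map_product_projection) auto
  ultimately show ?thesis
    unfolding nsphere continuous_map_in_subtopology
    by (auto simp: continuous_map_from_subtopology)
qed

text \<open>Conjugation by the swap of coordinates \<open>0\<close> and \<open>k\<close> reduces
  this to the reflection in coordinate \<open>0\<close>. The swap is an involution, so its degree
  squares to 1 and cancels.\<close>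

lemma Brouwer_degree2_reflection_coordinate:
  assumes "k \<le> p"
  shows "Brouwer_degree2 p (\<lambda>x i. if i = k then - x i else x i) = - 1"
proof -
  define s where "s = (\<lambda>(x::nat \<Rightarrow> real) i. x (Transposition.transpose 0 k i))"
  define r where "r = (\<lambda>k (x::nat \<Rightarrow> real) i. if i = k then - x i else x i)"
  have "Transposition.transpose 0 k permutes {..p}"
    using assms by (intro permutes_swap_id) auto
  then have s: "continuous_map (nsphere p) (nsphere p) s"
    using continuous_map_nsphere_sign_permute[of _ p "\<lambda>_. 1"] by (simp add: s_def)
  have r: "continuous_map (nsphere p) (nsphere p) (r j)" for j
    unfolding r_def by (rule continuous_map_nsphere_reflection)
  have "s \<circ> s = id"
    by (auto simp: s_def)
  then have ss: "Brouwer_degree2 p s * Brouwer_degree2 p s = 1"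
    using Brouwer_degree2_compose[OF s s] by simp
  have "r k = s \<circ> (r 0 \<circ> s)"
    by (auto simp: s_def r_def fun_eq_iff Transposition.transpose_def)
  then have "Brouwer_degree2 p (r k)
      = Brouwer_degree2 p s * (Brouwer_degree2 p (r 0) * Brouwer_degree2 p s)"
    by (simp add: Brouwer_degree2_compose r s continuous_map_compose[OF s r])
  then show ?thesis
    using ss Brouwer_degree2_reflection[of p] by (simp add: r_def)
qed

text \<open>On the sphere, negation is a composite of \<open>p + 1\<close> coordinate reflections,
  each of degree -1.\<close>

lemma Brouwer_degree2_uminus:
  "Brouwer_degree2 p (\<lambda>x i. - x i) = (- 1) ^ Suc p"
proof -
  define neg where "neg = (\<lambda>k (x::nat \<Rightarrow> real) i. if i < k then - x i else x i)"
  have neg: "continuous_map (nsphere p) (nsphere p) (neg k)" for k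
    using continuous_map_nsphere_sign_permute[OF permutes_id, of "\<lambda>i. if i < k then -1 else 1" p]
    by (simp add: neg_def if_distrib[of "\<lambda>t. t * _"] cong: if_cong)
  have "Brouwer_degree2 p (neg k) = (- 1) ^ k" if "k \<le> Suc p" for k
    using that
  proof (induction k)
    case 0
    have "neg 0 = id" by (auto simp: neg_def)
    then show ?case by (metis Brouwer_degree2_id power_0)
  next
    case (Suc k)
    have "neg (Suc k) = (\<lambda>x i. if i = k then - x i else x i) \<circ> neg k"
      by (auto simp: neg_def fun_eq_iff)
    then have "Brouwer_degree2 p (neg (Suc k)) = - 1 * Brouwer_degree2 p (neg k)"
      using Suc.prems Brouwer_degree2_compose[OF neg continuous_map_nsphere_reflection]
      by (simp only: Brouwer_degree2_reflection_coordinate Suc_le_mono)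
    with Suc show ?case
      by simp
  qed
  \<comment> \<open>The two maps agree only on the sphere, where the coordinates beyond
    \<open>p\<close> vanish; equality there is turned into a homotopy.\<close>
  moreover have "Brouwer_degree2 p (\<lambda>x i. - x i) = Brouwer_degree2 p (neg (Suc p))"
  proof (rule Brouwer_degree2_homotopic, rule homotopic_with_equal)
    show "continuous_map (nsphere p) (nsphere p) (\<lambda>x i. - x i)"
      using continuous_map_nsphere_sign_permute[OF permutes_id, of "\<lambda>_. -1" p] by simp
  qed (auto simp: neg_def nsphere less_Suc_eq_le not_le)
  ultimately show ?thesis by simp
qed

section \<open>Square roots of negation on spheres and near the origin\<close>

text \<open>The sphere \<open>S\<close> has even dimension, so its antipodal map has degree -1,
  while homotopic \<open>g\<close> and \<open>h\<close> share a degree whose square is the degree of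
  \<open>h \<circ> g\<close>. Two maps are allowed because the charts at the two ends of a path will
  give two different maps.\<close>

lemma no_square_root_of_antipodal_map:
  fixes V :: "'a::euclidean_space set"
  assumes "subspace V" and odd: "odd (dim V)" and S: "S = sphere 0 1 \<inter> V"
    and gh: "homotopic_with_canon (\<lambda>_. True) S S g h"
    and hg: "homotopic_with_canon (\<lambda>_. True) S S (h \<circ> g) uminus"
  shows False
proof -
  obtain p where p: "dim V = Suc p" "even p"
    using odd by (cases "dim V") auto
  obtain B where B: "B \<subseteq> V" "pairwise orthogonal B" "\<And>x. x \<in> B \<Longrightarrow> norm x = 1"
      "independent B" "card B = dim V" "span B = V"
    using orthonormal_basis_subspace[OF \<open>subspace V\<close>] by metis
  have "finite B" using B independent_imp_finite by blast
  then obtain b where b: "bij_betw b {..p} B"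
    using B p by (metis atMost_atLeast0 card_atMost finite_atMost finite_same_card_bij)
  have bb: "b i \<bullet> b j = (if i = j then 1 else 0)" if "i \<le> p" "j \<le> p" for i j
  proof (cases "i = j")
    case True
    then show ?thesis
      using B(3)[of "b i"] b that by (auto simp: bij_betw_def norm_eq_1)
  next
    case False
    then have "b i \<noteq> b j" "b i \<in> B" "b j \<in> B"
      using b that by (auto simp: bij_betw_def inj_on_def)
    then show ?thesis
      using B(2) False by (auto simp: pairwise_def orthogonal_def)
  qed
  \<comment> \<open>\<open>T\<close> takes coordinates in the orthonormal basis and \<open>R\<close>
    rebuilds the vector. They identify \<open>S\<close> with \<open>nsphere p\<close>, where the
    degree is available.\<close>
  define T where "T = (\<lambda>x i. if i \<le> p then x \<bullet> b i else 0)"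
  define R where "R = (\<lambda>y::nat \<Rightarrow> real. \<Sum>i\<le>p. y i *\<^sub>R b i)"
  have Rb: "R y \<bullet> b j = y j" if "j \<le> p" for y j
    using that by (simp add: R_def inner_sum_left bb if_distrib[of "\<lambda>t. _ * t"] cong: if_cong)
  have normR: "norm (R y) ^ 2 = (\<Sum>i\<le>p. (y i)\<^sup>2)" for y
  proof -
    have "norm (R y) ^ 2 = R y \<bullet> R y" by (simp add: power2_norm_eq_inner)
    also have "\<dots> = (\<Sum>i\<le>p. y i * (R y \<bullet> b i))"
      by (subst (2) R_def) (simp add: inner_sum_right)
    also have "\<dots> = (\<Sum>i\<le>p. (y i)\<^sup>2)"
      by (intro sum.cong) (auto simp: Rb power2_eq_square)
    finally show ?thesis .
  qed
  have RV: "R y \<in> V" for y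
    unfolding R_def using B(1) b \<open>subspace V\<close>
    by (intro subspace_sum subspace_scale) (auto simp: bij_betw_def)
  have RT: "R (T x) = x" if "x \<in> V" for x
  proof -
    have "x - R (T x) \<in> span B"
      using B(6) RV that \<open>subspace V\<close> subspace_diff by blast
    moreover have "orthogonal (x - R (T x)) y" if "y \<in> B" for y
    proof -
      obtain j where "j \<le> p" "y = b j"
        using \<open>y \<in> B\<close> b by (auto simp: bij_betw_def)
      then show ?thesis
        by (simp add: orthogonal_def inner_diff_left Rb) (simp add: T_def)
    qed
    ultimately have "orthogonal (x - R (T x)) (x - R (T x))"
      using orthogonal_to_span by blast
    then show ?thesis by (simp add: orthogonal_def)
  qed
  let ?S = "top_of_set S"
  have contR: "continuous_map (nsphere p) ?S R"
    unfolding continuous_map_in_subtopology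
  proof
    show "continuous_map (nsphere p) euclidean R"
      unfolding R_def nsphere euclidean_product_topology continuous_map_iff_continuous
      by (intro continuous_intros continuous_on_subset[OF continuous_on_product_coordinates]) auto
    have "norm (R y) = 1" if "y \<in> topspace (nsphere p)" for y
      using normR[of y] that by (simp add: nsphere) (metis abs_norm_cancel abs_1 power2_eq_1_iff abs_minus_cancel)
    then show "R \<in> topspace (nsphere p) \<rightarrow> S"
      using RV by (auto simp: S)
  qed
  have contT: "continuous_map ?S (nsphere p) T"
    unfolding nsphere continuous_map_in_subtopology
  proof
    show "continuous_map ?S (powertop_real UNIV) T"
      unfolding continuous_map_componentwise_UNIV T_def
      by (auto intro!: continuous_intros)
    have "(\<Sum>i\<le>p. (T x i)\<^sup>2) = 1" if "x \<in> S" for x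
      using normR[of "T x"] RT[of x] that by (simp add: S)
    then show "T \<in> topspace ?S \<rightarrow> {x. (\<Sum>i\<le>p. (x i)\<^sup>2) = 1 \<and> (\<forall>i>p. x i = 0)}"
      by (auto simp: T_def)
  qed
  have g: "continuous_map ?S ?S g" and h: "continuous_map ?S ?S h"
    using homotopic_with_imp_continuous_maps[OF gh] by auto
  define G where "G = T \<circ> g \<circ> R"
  define H where "H = T \<circ> h \<circ> R"
  have transfer: "homotopic_with (\<lambda>_. True) (nsphere p) (nsphere p) (T \<circ> u \<circ> R) (T \<circ> v \<circ> R)"
    if "homotopic_with_canon (\<lambda>_. True) S S u v" for u v
    using that contR contT
    by (intro homotopic_with_compose_continuous_map_right[where p="\<lambda>_. True"]
        homotopic_with_compose_continuous_map_left[where p="\<lambda>_. True"]) auto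
  have contG: "continuous_map (nsphere p) (nsphere p) G"
    and contH: "continuous_map (nsphere p) (nsphere p) H"
    using homotopic_with_imp_continuous_maps[OF transfer[OF gh]] by (auto simp: G_def H_def)
  have "Brouwer_degree2 p G = Brouwer_degree2 p H"
    using transfer[OF gh] by (simp add: G_def H_def Brouwer_degree2_homotopic)
  moreover have "Brouwer_degree2 p (H \<circ> G) = - 1"
  proof -
    \<comment> \<open>The composite contains \<open>R \<circ> T\<close> in the middle, which is the
      identity on \<open>V\<close>; it matters that \<open>g\<close> keeps its values in
      \<open>S\<close>.\<close>
    have "homotopic_with (\<lambda>_. True) (nsphere p) (nsphere p) (H \<circ> G) (T \<circ> (h \<circ> g) \<circ> R)"
    proof (rule homotopic_with_equal)
      show "continuous_map (nsphere p) (nsphere p) (H \<circ> G)"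
        using contG contH continuous_map_compose by blast
      fix y assume "y \<in> topspace (nsphere p)"
      then have "g (R y) \<in> S"
        using continuous_map_compose[OF contR g] by (auto simp: continuous_map_def)
      then show "(H \<circ> G) y = (T \<circ> (h \<circ> g) \<circ> R) y"
        by (simp add: G_def H_def RT S)
    qed auto
    moreover have "homotopic_with (\<lambda>_. True) (nsphere p) (nsphere p) (T \<circ> uminus \<circ> R) (\<lambda>x i. - x i)"
    proof (rule homotopic_with_equal)
      show "continuous_map (nsphere p) (nsphere p) (T \<circ> uminus \<circ> R)"
        using homotopic_with_imp_continuous_maps[OF transfer[OF hg]] by auto
      fix y assume "y \<in> topspace (nsphere p)"
      then show "(T \<circ> uminus \<circ> R) y = (\<lambda>i. - y i)"
        by (auto simp: T_def Rb nsphere fun_eq_iff)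
    qed auto
    ultimately have "homotopic_with (\<lambda>_. True) (nsphere p) (nsphere p) (H \<circ> G) (\<lambda>x i. - x i)"
      using transfer[OF hg] homotopic_with_trans by blast
    then have "Brouwer_degree2 p (H \<circ> G) = (- 1) ^ Suc p"
      using Brouwer_degree2_homotopic Brouwer_degree2_uminus by metis
    then show ?thesis using \<open>even p\<close> by simp
  qed
  ultimately have "Brouwer_degree2 p H * Brouwer_degree2 p H = - 1"
    using Brouwer_degree2_compose[OF contG contH] by simp
  then show False
    using zero_le_square[of "Brouwer_degree2 p H"] by linarith
qed

lemma homotopic_with_canonI:
  fixes H :: "real \<Rightarrow> 'a::real_normed_vector \<Rightarrow> 'b::real_normed_vector"
  assumes "continuous_on ({0..1} \<times> S) (\<lambda>z. H (fst z) (snd z))"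
    "\<And>t x. \<lbrakk>t \<in> {0..1}; x \<in> S\<rbrakk> \<Longrightarrow> H t x \<in> T"
    "\<And>x. x \<in> S \<Longrightarrow> H 0 x = f x" "\<And>x. x \<in> S \<Longrightarrow> H 1 x = g x"
  shows "homotopic_with_canon (\<lambda>_. True) S T f g"
proof (subst homotopic_with)
  show "\<exists>k. continuous_map (prod_topology (top_of_set {0..1::real}) (top_of_set S)) (top_of_set T) k \<and>
      (\<forall>x\<in>topspace (top_of_set S). k (0, x) = f x) \<and>
      (\<forall>x\<in>topspace (top_of_set S). k (1, x) = g x) \<and> (\<forall>t\<in>{0..1::real}. True)"
    using assms by (intro exI[of _ "\<lambda>z. H (fst z) (snd z)"]) auto
qed auto

text \<open>As \<open>\<Phi> t\<close> vanishes only at the origin, normalising it on a small sphere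
  gives self-maps of the unit sphere of \<open>V\<close>, homotopic to one another in
  \<open>t\<close>. The hypothesis \<open>square\<close> makes the composite of the two end maps
  homotopic to the antipodal map.\<close>

lemma no_local_square_root_of_uminus:
  fixes V :: "'a::euclidean_space set" and \<Phi> :: "real \<Rightarrow> 'a \<Rightarrow> 'a"
  assumes V: "subspace V" "odd (dim V)" and "R > 0"
    and cont: "continuous_on ({0..1} \<times> (cball 0 R \<inter> V)) (\<lambda>(t, v). \<Phi> t v)"
    and inV: "\<And>t v. \<lbrakk>t \<in> {0..1}; v \<in> V; norm v \<le> R\<rbrakk> \<Longrightarrow> \<Phi> t v \<in> V"
    and zero: "\<And>t v. \<lbrakk>t \<in> {0..1}; v \<in> V; norm v \<le> R\<rbrakk> \<Longrightarrow> \<Phi> t v = 0 \<longleftrightarrow> v = 0"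
    and square: "\<And>v. \<lbrakk>v \<in> V; norm v \<le> R; norm (\<Phi> 0 v) \<le> R\<rbrakk> \<Longrightarrow> \<Phi> 1 (\<Phi> 0 v) = - v"
  shows False
proof -
  define S where "S = sphere 0 1 \<inter> V"
  have cont_comp: "continuous_on X (\<lambda>x. \<Phi> (p x) (q x))"
    if "continuous_on X p" "continuous_on X q"
      "\<And>x. x \<in> X \<Longrightarrow> p x \<in> {0..1} \<and> q x \<in> V \<and> norm (q x) \<le> R"
    for X :: "(real \<times> 'a) set" and p q
  proof -
    have "continuous_on X ((\<lambda>(t, v). \<Phi> t v) \<circ> (\<lambda>x. (p x, q x)))"
      using that by (intro continuous_on_compose continuous_intros continuous_on_subset[OF cont]) auto
    then show ?thesis by (simp add: o_def)
  qed
  have "continuous_on (cball 0 R \<inter> V) (\<Phi> 0)"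
  proof -
    have "continuous_on (cball 0 R \<inter> V) ((\<lambda>(t, v). \<Phi> t v) \<circ> (\<lambda>v. (0, v)))"
      by (intro continuous_on_compose continuous_intros continuous_on_subset[OF cont]) auto
    then show ?thesis by (simp add: o_def)
  qed
  moreover have "0 \<in> cball 0 R \<inter> V" "\<Phi> 0 0 = 0"
    using V \<open>R > 0\<close> zero[of 0 0] subspace_0[OF V(1)] by auto
  ultimately obtain d where d: "d > 0"
      "\<And>v. \<lbrakk>v \<in> cball 0 R \<inter> V; norm v < d\<rbrakk> \<Longrightarrow> norm (\<Phi> 0 v) < R"
    using \<open>R > 0\<close> unfolding continuous_on_iff by (metis dist_0_norm dist_commute)
  \<comment> \<open>On the ball of radius \<open>r\<close> the values of \<open>\<Phi> 0\<close>
    stay in the ball of radius \<open>R\<close>, where \<open>\<Phi> 1\<close> is controlled.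
    Halving \<open>d\<close> turns the closed bound on the norm into the strict one.\<close>
  define r where "r = min R (d/2)"
  have r: "0 < r" "r \<le> R" "\<And>v. \<lbrakk>v \<in> V; norm v \<le> r\<rbrakk> \<Longrightarrow> norm (\<Phi> 0 v) \<le> R"
    using d \<open>R > 0\<close> by (auto simp: r_def intro!: less_imp_le)
  have sgnS: "sgn x \<in> S" if "x \<in> V" "x \<noteq> 0" for x
    using that V by (simp add: S_def norm_sgn sgn_div_norm subspace_scale)
  have scale: "c *\<^sub>R u \<in> V" "norm (c *\<^sub>R u) = c" "c *\<^sub>R u \<noteq> 0" if "u \<in> S" "c > 0" for c u
    using that V by (auto simp: S_def subspace_scale)
  have \<Phi>nz: "\<Phi> t v \<in> V \<and> \<Phi> t v \<noteq> 0" if "t \<in> {0..1}" "v \<in> V" "norm v \<le> R" "v \<noteq> 0" for t v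
    using that inV zero by auto
  show False
  proof (rule no_square_root_of_antipodal_map[OF V S_def])
    show "homotopic_with_canon (\<lambda>_. True) S S
        (\<lambda>u. sgn (\<Phi> 0 (r *\<^sub>R u))) (\<lambda>u. sgn (\<Phi> 1 (r *\<^sub>R u)))"
    proof (rule homotopic_with_canonI[where H="\<lambda>t u. sgn (\<Phi> t (r *\<^sub>R u))"])
      show "continuous_on ({0..1} \<times> S) (\<lambda>z. sgn (\<Phi> (fst z) (r *\<^sub>R snd z)))"
        using scale[OF _ r(1)] r(2) \<Phi>nz
        by (intro continuous_on_sgn cont_comp continuous_intros ballI) force+
    qed (use scale[OF _ r(1)] r(2) \<Phi>nz sgnS in auto)
    \<comment> \<open>The composite of the normalised maps evaluates \<open>\<Phi> 1\<close> on the
      sphere of radius \<open>r\<close>, whereas \<open>square\<close> concerns its value at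
      \<open>\<Phi> 0 (r *\<^sub>R u)\<close>. The radius \<open>\<rho>\<close> moves along the ray
      from one point to the other, staying positive and at most \<open>R\<close>.\<close>
    define \<rho> where "\<rho> = (\<lambda>t u. (1 - t) * r + t * norm (\<Phi> 0 (r *\<^sub>R u)))"
    define w where "w = (\<lambda>t u. \<rho> t u *\<^sub>R sgn (\<Phi> 0 (r *\<^sub>R u)))"
    have \<Phi>0: "\<Phi> 0 (r *\<^sub>R u) \<in> V" "\<Phi> 0 (r *\<^sub>R u) \<noteq> 0" "norm (\<Phi> 0 (r *\<^sub>R u)) \<le> R"
      if "u \<in> S" for u
      using scale[OF that r(1)] r \<Phi>nz[of 0 "r *\<^sub>R u"] by auto
    have \<rho>: "0 < \<rho> t u" "\<rho> t u \<le> R" if "t \<in> {0..1}" "u \<in> S" for t u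
    proof -
      show "0 < \<rho> t u"
      proof (cases "t = 0")
        case False
        then show ?thesis
          using that \<Phi>0[OF that(2)] r(1) unfolding \<rho>_def
          by (intro add_nonneg_pos mult_nonneg_nonneg mult_pos_pos) auto
      qed (use r(1) in \<open>simp add: \<rho>_def\<close>)
      have "\<rho> t u \<le> (1 - t) * R + t * R"
        using that \<Phi>0[OF that(2)] r(2) unfolding \<rho>_def
        by (intro add_mono mult_left_mono) auto
      then show "\<rho> t u \<le> R" by (simp add: algebra_simps)
    qed
    have w: "w t u \<in> V \<and> norm (w t u) \<le> R \<and> w t u \<noteq> 0" if "t \<in> {0..1}" "u \<in> S" for t u
      using scale[OF sgnS[OF \<Phi>0(1,2)[OF that(2)]] \<rho>(1)[OF that]] \<rho>(2)[OF that]
      by (simp add: w_def)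
    have contS: "continuous_on ({0..1::real} \<times> S) (\<lambda>z. \<Phi> 0 (r *\<^sub>R snd z))"
      using scale[OF _ r(1)] r(2) by (intro cont_comp continuous_intros) auto
    have contw: "continuous_on ({0..1} \<times> S) (\<lambda>z. w (fst z) (snd z))"
      unfolding w_def \<rho>_def using \<Phi>0
      by (intro continuous_intros continuous_on_sgn contS) auto
    show "homotopic_with_canon (\<lambda>_. True) S S
        ((\<lambda>u. sgn (\<Phi> 1 (r *\<^sub>R u))) \<circ> (\<lambda>u. sgn (\<Phi> 0 (r *\<^sub>R u)))) uminus"
    proof (rule homotopic_with_canonI[where H="\<lambda>t u. sgn (\<Phi> 1 (w t u))"])
      show "continuous_on ({0..1} \<times> S) (\<lambda>z. sgn (\<Phi> 1 (w (fst z) (snd z))))"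
        using w \<Phi>nz
        by (intro continuous_on_sgn cont_comp contw continuous_intros ballI) force+
      fix u assume u: "u \<in> S"
      have "w 1 u = \<Phi> 0 (r *\<^sub>R u)"
        using \<Phi>0[OF u] by (simp add: w_def \<rho>_def sgn_div_norm)
      then have "\<Phi> 1 (w 1 u) = - (r *\<^sub>R u)"
        using square[of "r *\<^sub>R u"] scale[OF u r(1)] \<Phi>0[OF u] r(2) by simp
      then show "sgn (\<Phi> 1 (w 1 u)) = - u"
        using u r(1) by (simp add: sgn_minus sgn_scaleR) (simp add: S_def sgn_div_norm)
      show "sgn (\<Phi> 1 (w 0 u)) = ((\<lambda>u. sgn (\<Phi> 1 (r *\<^sub>R u))) \<circ> (\<lambda>u. sgn (\<Phi> 0 (r *\<^sub>R u)))) u"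
        by (simp add: w_def \<rho>_def)
    qed (use w \<Phi>nz sgnS in auto)
  qed
qed


section \<open>Continuity of the matrix operations\<close>

text \<open>In this form the interpretation yields distributivity, scaling and continuity of the
  matrix product at once.\<close>

lemma bounded_bilinear_matrix_mult:
  "bounded_bilinear ((**) :: real^'n^'n \<Rightarrow> real^'n^'n \<Rightarrow> real^'n^'n)"
  unfolding bilinear_conv_bounded_bilinear[symmetric] bilinear_def
  by (auto intro!: linearI
      simp: vec_eq_iff matrix_matrix_mult_def distrib_left distrib_right sum.distrib sum_distrib_left mult_ac)

interpretation matrix_mult: bounded_bilinear "(**) :: real^'n^'n \<Rightarrow> real^'n^'n \<Rightarrow> real^'n^'n"
  by (rule bounded_bilinear_matrix_mult)

lemma linear_transpose: "linear (transpose :: real^'n^'n \<Rightarrow> real^'n^'n)"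
  by (auto intro!: linearI simp: vec_eq_iff transpose_def)

lemmas transpose_simps = linear_0[OF linear_transpose] linear_add[OF linear_transpose]
  linear_diff[OF linear_transpose] linear_cmul[OF linear_transpose]

lemma continuous_on_transpose:
  fixes f :: "_ \<Rightarrow> real^'n^'n"
  shows "continuous_on S f \<Longrightarrow> continuous_on S (\<lambda>x. transpose (f x))"
  unfolding transpose_def by (intro continuous_on_vec_lambda continuous_on_component)

lemma continuous_on_det:
  fixes f :: "_ \<Rightarrow> real^'n^'n"
  assumes "continuous_on S f"
  shows "continuous_on S (\<lambda>x. det (f x))"
  unfolding det_def using assms by (intro continuous_intros)

lemma matrix_inv_mult:
  fixes A :: "real^'n^'n"
  assumes "det A \<noteq> 0"
  shows "A ** matrix_inv A = mat 1" "matrix_inv A ** A = mat 1"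
proof -
  have "\<exists>B. A ** B = mat 1 \<and> B ** A = mat 1"
    using assms by (simp add: invertible_det_nz[symmetric] invertible_def)
  then have "A ** matrix_inv A = mat 1 \<and> matrix_inv A ** A = mat 1"
    unfolding matrix_inv_def by (rule someI_ex)
  then show "A ** matrix_inv A = mat 1" "matrix_inv A ** A = mat 1" by auto
qed

text \<open>Cramer's rule, applied to each column of the inverse, writes the entries as quotients of
  determinants.\<close>

lemma continuous_on_matrix_inv:
  fixes f :: "_ \<Rightarrow> real^'n^'n"
  assumes f: "continuous_on S f" and nz: "\<And>x. x \<in> S \<Longrightarrow> det (f x) \<noteq> 0"
  shows "continuous_on S (\<lambda>x. matrix_inv (f x))"
proof -
  let ?C = "\<lambda>l k x. \<chi> i j. if j = k then axis l 1 $ i else f x $ i $ j"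
  have "matrix_inv A $ k $ l = det (\<chi> i j. if j = k then axis l 1 $ i else A $ i $ j) / det A"
    if "det A \<noteq> 0" for A :: "real^'n^'n" and k l
  proof -
    have "A *v (matrix_inv A *v axis l 1) = axis l 1"
      by (simp add: matrix_vector_mul_assoc matrix_inv_mult[OF that])
    then have "matrix_inv A *v axis l 1
        = (\<chi> k. det (\<chi> i j. if j = k then axis l 1 $ i else A $ i $ j) / det A)"
      unfolding cramer[OF that] .
    then show ?thesis
      by (simp add: vec_eq_iff matrix_vector_mult_basis column_def)
  qed
  then have "matrix_inv (f x) = (\<chi> k l. det (?C l k x) / det (f x))" if "x \<in> S" for x
    using nz[OF that] by (simp add: vec_eq_iff)
  then have eq: "continuous_on S (\<lambda>x. matrix_inv (f x)) \<longleftrightarrow>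
      continuous_on S (\<lambda>x. \<chi> k l. det (?C l k x) / det (f x))"
    by (intro continuous_on_cong refl)
  have "continuous_on S (\<lambda>x. f x $ i $ j)" for i j
    using f by (intro continuous_on_component)
  then have "continuous_on S (\<lambda>x. if j = k then axis l 1 $ i else f x $ i $ j)" for i j k l
    by (cases "j = k") simp_all
  then have "continuous_on S (\<lambda>x. det (?C l k x))" for k l
    by (intro continuous_on_det continuous_on_vec_lambda)
  then have "continuous_on S (\<lambda>x. \<chi> k l. det (?C l k x) / det (f x))"
    using nz continuous_on_det[OF f] by (intro continuous_on_vec_lambda continuous_on_divide) auto
  then show ?thesis unfolding eq .
qed

section \<open>The Cayley transform as a chart of the rotation group\<close>

text \<open>The Cayley transform, an involution on the matrices with
  \<open>det (mat 1 + M) \<noteq> 0\<close>. It exchanges \<open>0\<close> with the identity, and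
  skew-symmetric matrices with the rotations in this domain, so the same formula is both the chart
  and its inverse.\<close>

definition cayley :: "real^'n^'n \<Rightarrow> real^'n^'n"
  where "cayley M = (mat 1 - M) ** matrix_inv (mat 1 + M)"

lemma det_nonzero_cancel:
  fixes A X Y :: "real^'n^'n"
  assumes "det A \<noteq> 0"
  shows "X ** A = Y ** A \<longleftrightarrow> X = Y" "A ** X = A ** Y \<longleftrightarrow> X = Y"
proof -
  have "X ** A ** matrix_inv A = X" for X :: "real^'n^'n"
    by (simp add: matrix_inv_mult[OF assms] flip: matrix_mul_assoc)
  then show "X ** A = Y ** A \<longleftrightarrow> X = Y"
    by metis
  have "matrix_inv A ** (A ** X) = X" for X :: "real^'n^'n"
    by (simp add: matrix_inv_mult[OF assms] matrix_mul_assoc)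
  then show "A ** X = A ** Y \<longleftrightarrow> X = Y"
    by metis
qed

text \<open>Both orders hold because \<open>mat 1 + M\<close> and \<open>mat 1 - M\<close>
  commute.\<close>

lemma cayley_mult:
  assumes "det (mat 1 + M) \<noteq> 0"
  shows "cayley M ** (mat 1 + M) = mat 1 - M" "(mat 1 + M) ** cayley M = mat 1 - M"
proof -
  show *: "cayley M ** (mat 1 + M) = mat 1 - M"
    using assms by (simp add: cayley_def matrix_inv_mult flip: matrix_mul_assoc)
  have "(mat 1 + M) ** cayley M ** (mat 1 + M) = (mat 1 + M) ** (mat 1 - M)"
    by (simp add: * flip: matrix_mul_assoc)
  also have "\<dots> = (mat 1 - M) ** (mat 1 + M)"
    by (simp add: matrix_mult.add_left matrix_mult.add_right matrix_mult.diff_left matrix_mult.diff_right)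
  finally show "(mat 1 + M) ** cayley M = mat 1 - M"
    using assms by (simp add: det_nonzero_cancel)
qed

lemma cayley_unique:
  assumes "det (mat 1 + M) \<noteq> 0" "X ** (mat 1 + M) = mat 1 - M"
  shows "cayley M = X"
  using cayley_mult[OF assms(1)] det_nonzero_cancel(1)[OF assms(1)] assms(2) by metis

text \<open>Adding \<open>mat 1 + M\<close> to the defining equation gives twice the identity, which
  exhibits an inverse of \<open>mat 1 + cayley M\<close>.\<close>

lemma det_one_plus_cayley:
  assumes "det (mat 1 + M) \<noteq> 0"
  shows "det (mat 1 + cayley M) \<noteq> 0"
proof -
  have "(mat 1 + cayley M) ** (mat 1 + M) = 2 *\<^sub>R mat 1"
    using cayley_mult[OF assms] by (simp add: matrix_mult.add_left scaleR_2)
  then have "((mat 1 + M) ** ((1/2) *\<^sub>R (mat 1 + cayley M))) = mat 1"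
    by (subst matrix_left_right_inverse) (simp add: matrix_mult.scaleR_left)
  then have "((1/2) *\<^sub>R (mat 1 + M)) ** (mat 1 + cayley M) = mat 1"
    by (simp add: matrix_mult.scaleR_left matrix_mult.scaleR_right)
  then have "det ((1/2) *\<^sub>R (mat 1 + M)) * det (mat 1 + cayley M) = 1"
    by (metis det_mul det_I)
  then show ?thesis by auto
qed

text \<open>Multiplied by \<open>mat 1 + M\<close>, the sum and difference of the identity and
  \<open>cayley M\<close> become twice the identity and twice \<open>M\<close>; cancelling that
  factor gives the equation that characterises the second transform.\<close>

lemma cayley_cayley:
  assumes "det (mat 1 + M) \<noteq> 0"
  shows "cayley (cayley M) = M"
proof (rule cayley_unique[OF det_one_plus_cayley[OF assms]])
  have "(mat 1 + cayley M) ** (mat 1 + M) = 2 *\<^sub>R mat 1"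
    "(mat 1 - cayley M) ** (mat 1 + M) = 2 *\<^sub>R M"
    using cayley_mult[OF assms] by (simp_all add: matrix_mult.add_left matrix_mult.diff_left scaleR_2)
  then have "M ** (mat 1 + cayley M) ** (mat 1 + M) = (mat 1 - cayley M) ** (mat 1 + M)"
    by (simp add: matrix_mult.scaleR_right flip: matrix_mul_assoc)
  then show "M ** (mat 1 + cayley M) = mat 1 - cayley M"
    using assms by (simp add: det_nonzero_cancel)
qed

lemma cayley_eq_1_iff:
  assumes "det (mat 1 + M) \<noteq> 0"
  shows "cayley M = mat 1 \<longleftrightarrow> M = 0"
proof
  assume "cayley M = mat 1"
  then have "mat 1 + M = mat 1 - M"
    using cayley_mult(1)[OF assms] by (metis matrix_mul_lid)
  then have "M = - M"
    by (simp only: diff_conv_add_uminus add_left_cancel)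
  then have "M + M = 0"
    by (simp only: eq_neg_iff_add_eq_0)
  then have "2 *\<^sub>R M = 0"
    by (simp only: scaleR_2)
  then show "M = 0" by simp
next
  assume "M = 0"
  then show "cayley M = mat 1"
    by (intro cayley_unique[OF assms]) simp
qed

lemma cayley_1: "cayley (mat 1 :: real^'n^'n) = 0"
  by (simp add: cayley_def matrix_mult.zero_left)

definition skew :: "(real^'n^'n) set"
  where "skew = {M. transpose M = - M}"

lemma subspace_skew: "subspace skew"
  unfolding skew_def subspace_def mem_Collect_eq by (simp add: transpose_simps)

text \<open>Skew-symmetry makes \<open>x \<bullet> (M *v x)\<close> vanish, so a kernel vector of
  \<open>mat 1 + M\<close> is orthogonal to itself.\<close>

lemma det_one_plus_skew:
  assumes "M \<in> skew"
  shows "det (mat 1 + M) \<noteq> 0"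
proof -
  have "x = 0" if "(mat 1 + M) *v x = 0" for x
  proof -
    have "x \<bullet> (M *v x) = (transpose M *v x) \<bullet> x"
      by (simp add: dot_lmul_matrix)
    also have "\<dots> = - ((M *v x) \<bullet> x)"
      using assms matrix_vector_mult_diff_rdistrib[of 0 M x] by (simp add: skew_def)
    finally have "x \<bullet> (M *v x) = 0" by (simp add: inner_commute)
    then have "x \<bullet> ((mat 1 + M) *v x) = x \<bullet> x"
      by (simp add: matrix_vector_mult_add_rdistrib inner_add_right)
    then show ?thesis using that by simp
  qed
  then have "\<exists>B. B ** (mat 1 + M) = mat 1"
    by (simp add: matrix_left_invertible_ker)
  then show ?thesis
    by (simp add: invertible_left_inverse flip: invertible_det_nz)
qed

text \<open>Transposition exchanges \<open>mat 1 + M\<close> and \<open>mat 1 - M\<close>, so the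
  two have equal determinants and the transposed Cayley equation is the one for \<open>- M\<close>.
  The second claim says that inversion in the group is negation in the chart.\<close>

lemma cayley_skew:
  assumes "M \<in> skew"
  shows "cayley M \<in> carrier SO" "cayley (- M) = transpose (cayley M)"
proof -
  note nz = det_one_plus_skew[OF assms]
  have T: "transpose (mat 1 + M) = mat 1 - M" "transpose (mat 1 - M) = mat 1 + M"
    using assms by (simp_all add: skew_def transpose_simps)
  have P: "(mat 1 - M) ** transpose (cayley M) = mat 1 + M"
    "transpose (cayley M) ** (mat 1 - M) = mat 1 + M"
    using cayley_mult(1)[OF nz, THEN arg_cong[of _ _ transpose]]
      cayley_mult(2)[OF nz, THEN arg_cong[of _ _ transpose]]
    by (simp_all only: matrix_transpose_mul T)
  have nz': "det (mat 1 - M) \<noteq> 0"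
    using nz det_transpose[of "mat 1 + M"] by (simp add: T)
  show "cayley (- M) = transpose (cayley M)"
    using P nz' by (intro cayley_unique) auto
  have "(mat 1 + M) ** (cayley M ** transpose (cayley M)) = (mat 1 + M) ** mat 1"
    using P cayley_mult[OF nz] by (simp add: matrix_mul_assoc)
  then have "cayley M ** transpose (cayley M) = mat 1"
    using nz det_nonzero_cancel by blast
  moreover have "det (cayley M) * det (mat 1 + M) = det (mat 1 + M)"
    using det_transpose[of "mat 1 + M"] cayley_mult(1)[OF nz, THEN arg_cong[of _ _ det]]
    by (simp add: det_mul T)
  ultimately show "cayley M \<in> carrier SO"
    using nz by (simp add: SO_simps)
qed

text \<open>Transposing the Cayley equation and multiplying by \<open>X\<close> from the left turns
  it into the equation satisfied by the negative of the transform.\<close>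

lemma cayley_SO:
  assumes "X \<in> carrier SO" "det (mat 1 + X) \<noteq> 0"
  shows "cayley X \<in> skew"
proof -
  have X: "X ** transpose X = mat 1" using assms by (simp add: SO_simps)
  let ?Y = "cayley X"
  have "(mat 1 + transpose X) ** transpose ?Y = mat 1 - transpose X"
    using arg_cong[OF cayley_mult(1)[OF assms(2)], of transpose]
    by (simp add: matrix_transpose_mul transpose_simps)
  then have "X ** (mat 1 + transpose X) ** transpose ?Y = X ** (mat 1 - transpose X)"
    by (simp flip: matrix_mul_assoc)
  then have "(mat 1 + X) ** transpose ?Y = X - mat 1"
    by (simp add: matrix_mult.add_right matrix_mult.diff_right X add.commute)
  also have "\<dots> = (mat 1 + X) ** (- ?Y)"
    using cayley_mult[OF assms(2)] by (simp add: matrix_mult.minus_right)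
  finally show ?thesis
    using assms(2) by (simp add: skew_def det_nonzero_cancel)
qed

lemma continuous_on_cayley:
  assumes "continuous_on S f" "\<And>x. x \<in> S \<Longrightarrow> det (mat 1 + f x) \<noteq> 0"
  shows "continuous_on S (\<lambda>x. cayley (f x))"
  unfolding cayley_def
  by (intro matrix_mult.continuous_on continuous_on_matrix_inv continuous_intros assms)


section \<open>The dimension of the space of skew-symmetric matrices\<close>

text \<open>The matrices \<open>E i j\<close>, one for each unordered pair of distinct indices, form
  an orthogonal basis. Doubling avoids division of natural numbers.\<close>

lemma two_times_dim_skew:
  "2 * dim (skew :: (real^'n^'n) set) = CARD('n) * (CARD('n) - 1)"
proof -
  define E :: "'n \<Rightarrow> 'n \<Rightarrow> real^'n^'n" where
    "E i j = axis i (axis j 1) - axis j (axis i 1)" for i j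
  \<comment> \<open>\<open>to_nat\<close> orders the index type, so that \<open>P\<close> picks each
    unordered pair once.\<close>
  define P :: "('n \<times> 'n) set" where "P = {(i, j). to_nat i < to_nat j}"
  have inner_E: "M \<bullet> E i j = M $ i $ j - M $ j $ i" for M i j
    by (simp add: E_def inner_diff_right inner_axis)
  have E_nth: "E i j $ k $ l = (if i = k \<and> j = l then 1 else 0) - (if j = k \<and> i = l then 1 else 0)"
    for i j k l
  proof -
    have "axis i (axis j (1::real)) $ k $ l = (if i = k \<and> j = l then 1 else 0)" for i j k l :: 'n
      by (cases "i = k"; cases "j = l") (simp_all add: axis_def)
    then show ?thesis
      by (simp only: E_def vector_minus_component)
  qed
  have E_skew: "E i j \<in> skew" for i j
  proof -
    have "transpose (E i j) $ k $ l = (- E i j) $ k $ l" for k l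
      by (simp only: transpose_def vec_lambda_beta vector_uminus_component E_nth
          minus_diff_eq conj_commute)
    then show ?thesis
      unfolding skew_def mem_Collect_eq by (intro iffD2[OF vec_eq_iff] allI)
  qed
  have inner_EE: "E i j \<bullet> E k l = (if (i, j) = (k, l) then 2 else 0)"
    if "(i, j) \<in> P" "(k, l) \<in> P" for i j k l
  proof -
    have "\<not> (l = i \<and> k = j)" "\<not> (k = i \<and> l = i)" "i \<noteq> j" "k \<noteq> l"
      using that by (auto simp: P_def)
    then show ?thesis
      unfolding inner_E E_nth by (cases "i = k"; cases "j = l") auto
  qed
  define B where "B = (\<lambda>(i, j). E i j) ` P"
  have inj: "inj_on (\<lambda>(i, j). E i j) P"
  proof (rule inj_onI, clarify)
    fix i j k l assume ij: "(i, j) \<in> P" and kl: "(k, l) \<in> P" and eq: "E i j = E k l"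
    have "E i j \<bullet> E k l = 2" unfolding eq inner_EE[OF kl kl] by simp
    then show "i = k \<and> j = l" using inner_EE[OF ij kl] by (simp split: if_splits)
  qed
  have "pairwise orthogonal B"
    unfolding pairwise_def B_def orthogonal_def by (auto simp: inner_EE split: if_splits)
  moreover have "0 \<notin> B"
  proof
    assume "0 \<in> B"
    then obtain i j where "(i, j) \<in> P" "E i j = 0" by (auto simp: B_def)
    then show False using inner_EE[of i j i j] by simp
  qed
  ultimately have "independent B"
    by (rule pairwise_orthogonal_independent)
  \<comment> \<open>That \<open>B\<close> spans is shown through a trivial orthogonal complement
    inside \<open>skew\<close>: the product with \<open>E i j\<close> reads off twice an
    entry.\<close>
  have "{M \<in> skew. \<forall>N \<in> span B. orthogonal N M} = {0}"
  proof (intro equalityI subsetI)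
    fix M :: "real^'n^'n" assume M: "M \<in> {M \<in> skew. \<forall>N \<in> span B. orthogonal N M}"
    then have tr: "transpose M = - M" and orth: "\<And>N. N \<in> span B \<Longrightarrow> N \<bullet> M = 0"
      by (simp_all add: skew_def orthogonal_def)
    have M_swap: "M $ j $ i = - (M $ i $ j)" for i j
    proof -
      have "transpose M $ i $ j = (- M) $ i $ j" by (simp only: tr)
      then show ?thesis by (simp add: transpose_def)
    qed
    have *: "M $ i $ j = 0 \<and> M $ j $ i = 0" if "(i, j) \<in> P" for i j
    proof -
      have "E i j \<in> span B"
        using that by (intro span_base) (auto simp: B_def)
      then have "M \<bullet> E i j = 0"
        using orth[of "E i j"] by (simp only: inner_commute)
      then show ?thesis
        using M_swap[of j i] unfolding inner_E by linarith
    qed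
    have "M $ i $ i = 0" for i
      using M_swap[of i i] by simp
    then have "M $ i $ j = 0" for i j
      using *[of i j] *[of j i] by (cases "to_nat i" "to_nat j" rule: linorder_cases) (auto simp: P_def)
    then show "M \<in> {0}" by (simp add: vec_eq_iff)
  qed (simp add: subspace_0[OF subspace_skew] orthogonal_def)
  moreover have "span B \<subseteq> skew"
    by (intro span_minimal subspace_skew) (auto simp: B_def E_skew)
  ultimately have "dim (skew :: (real^'n^'n) set) = card B"
    using dim_subspace_orthogonal_to_vectors[OF subspace_span[of B] subspace_skew]
      dim_eq_card_independent[OF \<open>independent B\<close>] by simp
  also have "\<dots> = card P"
    unfolding B_def by (rule card_image[OF inj])
  finally have "dim (skew :: (real^'n^'n) set) = card P" .
  moreover have "CARD('n) * CARD('n) = card P + card P + CARD('n)"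
  proof -
    \<comment> \<open>All index pairs split into those in \<open>P\<close>, their mirror images and
      the diagonal.\<close>
    have "(UNIV :: ('n \<times> 'n) set) = (P \<union> prod.swap ` P) \<union> range (\<lambda>i. (i, i))"
      by (auto simp: P_def image_iff)
    then have "CARD('n) * CARD('n) = card ((P \<union> prod.swap ` P) \<union> range (\<lambda>i. (i, i)))"
      by (metis UNIV_Times_UNIV card_cartesian_product)
    also have "\<dots> = card (P \<union> prod.swap ` P) + card (range (\<lambda>i::'n. (i, i)))"
      by (rule card_Un_disjoint) (auto simp: P_def)
    also have "card (P \<union> prod.swap ` P) = card P + card (prod.swap ` P)"
      by (rule card_Un_disjoint) (auto simp: P_def)
    also have "card (prod.swap ` P) = card P"
      by (intro card_image) (auto simp: inj_on_def)
    also have "card (range (\<lambda>i::'n. (i, i))) = CARD('n)"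
      by (intro card_image) (auto simp: inj_on_def)
    finally show ?thesis .
  qed
  ultimately show ?thesis
    by (simp add: algebra_simps)
qed

section \<open>Reflections and path-connectedness of the rotation group\<close>

text \<open>The Householder matrix; for a unit vector \<open>u\<close> it is the reflection in the
  hyperplane orthogonal to \<open>u\<close>.\<close>

definition reflection :: "real^'n \<Rightarrow> real^'n^'n"
  where "reflection u = mat 1 - 2 *\<^sub>R (\<chi> i j. u $ i * u $ j)"

lemma reflection_mult_vec: "reflection u *v x = x - (2 * (u \<bullet> x)) *\<^sub>R u"
proof -
  have "(\<chi> i j. u $ i * u $ j) *v x = (u \<bullet> x) *\<^sub>R u"
    by (simp add: vec_eq_iff matrix_vector_mult_def inner_vec_def sum_distrib_left mult_ac)
  then show ?thesis
    by (simp add: reflection_def matrix_vector_mult_diff_rdistrib flip: scaleR_matrix_vector_assoc)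
qed

lemma reflection_involution:
  assumes "norm u = 1"
  shows "reflection u ** reflection u = mat 1"
  unfolding matrix_eq
proof
  fix x
  have "2 * (u \<bullet> (x - (2 * (u \<bullet> x)) *\<^sub>R u)) = - (2 * (u \<bullet> x))"
    using assms by (simp add: inner_diff_right norm_eq_1)
  then show "reflection u ** reflection u *v x = mat 1 *v x"
    by (simp only: reflection_mult_vec matrix_vector_mul_lid flip: matrix_vector_mul_assoc) simp
qed

lemma transpose_reflection: "transpose (reflection u) = reflection u"
  by (simp add: reflection_def vec_eq_iff transpose_def mat_def mult.commute)

lemma continuous_on_reflection: "continuous_on S reflection"
  unfolding reflection_def
  by (intro continuous_intros continuous_on_vec_lambda continuous_on_component)

lemma det_reflection_axis: "det (reflection (axis k 1)) = - 1"
proof -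
  have "det (reflection (axis k 1)) = (\<Prod>i\<in>UNIV. reflection (axis k 1) $ i $ i)"
    by (rule det_diagonal) (auto simp: reflection_def mat_def axis_def)
  also have "\<dots> = (\<Prod>i\<in>UNIV. if i = k then - 1 else 1)"
    by (intro prod.cong) (auto simp: reflection_def mat_def axis_def)
  finally show ?thesis by simp
qed

lemma path_component_continuous_image:
  assumes "path_component S x y" "continuous_on S f" "f ` S \<subseteq> T"
  shows "path_component T (f x) (f y)"
proof -
  obtain g where g: "path g" "path_image g \<subseteq> S" "pathstart g = x" "pathfinish g = y"
    using assms(1) by (auto simp: path_component_def)
  then have "path (f \<circ> g)"
    using assms(2) by (intro path_continuous_image) (auto intro: continuous_on_subset)
  then show ?thesis
    unfolding path_component_def using g assms(3)
    by (intro exI[of _ "f \<circ> g"]) (auto simp: path_image_compose pathstart_compose pathfinish_compose)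
qed

text \<open>Paths are first built here, because reflections have determinant -1 and lie outside
  \<open>SO\<close>.\<close>

abbreviation orthogonal_group :: "(real^'n^'n) set"
  where "orthogonal_group \<equiv> {A. A ** transpose A = mat 1}"

lemma orthogonal_group_mult:
  "A \<in> orthogonal_group \<Longrightarrow> B \<in> orthogonal_group \<Longrightarrow> A ** B \<in> orthogonal_group"
  by (simp add: matrix_transpose_mul)
     (metis matrix_mul_assoc matrix_mul_rid)

lemma reflection_orthogonal: "norm u = 1 \<Longrightarrow> reflection u \<in> orthogonal_group"
  by (simp add: transpose_reflection reflection_involution)

lemma path_component_orthogonal_group_mult:
  assumes "path_component orthogonal_group A B" "C \<in> orthogonal_group"
  shows "path_component orthogonal_group (C ** A) (C ** B)"
  using assms(1)
proof (rule path_component_continuous_image[where f="(**) C"])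
  show "continuous_on orthogonal_group ((**) C)"
    by (intro matrix_mult.continuous_on continuous_intros)
qed (use orthogonal_group_mult[OF assms(2)] in auto)

text \<open>The unit sphere is path-connected from dimension 2 on, and a reflection depends
  continuously on its unit normal.\<close>

lemma path_component_reflections:
  fixes u v :: "real^'n"
  assumes "CARD('n) \<ge> 2" "norm u = 1" "norm v = 1"
  shows "path_component orthogonal_group (reflection u) (reflection v)"
proof -
  have "path_component (sphere 0 1) u v"
    using assms path_connected_sphere_eq[of "0::real^'n" 1]
    by (auto simp: path_connected_component)
  then show ?thesis
    by (rule path_component_continuous_image)
      (auto simp: continuous_on_reflection reflection_involution transpose_reflection)
qed

text \<open>The determinant of an orthogonal matrix is 1 or -1, so along a path it sweeps out a
  finite connected set, a single point.\<close>

lemma path_component_orthogonal_group_det: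
  fixes A B :: "real^'n^'n"
  assumes "path_component orthogonal_group A B"
  shows "det A = det B"
proof -
  have det_cases: "det M = 1 \<or> det M = - 1" if "M ** transpose M = mat 1" for M :: "real^'n^'n"
    using arg_cong[OF that, of det] by (simp add: det_mul square_eq_1_iff)
  have dets: "det ` (orthogonal_group :: (real^'n^'n) set) \<subseteq> {-1, 1 :: real}"
  proof (rule image_subsetI)
    fix M :: "real^'n^'n" assume "M \<in> orthogonal_group"
    then show "det M \<in> {-1, 1}" using det_cases[of M] by auto
  qed
  have "path_component {-1, 1 :: real} (det A) (det B)"
    using assms by (rule path_component_continuous_image[where f=det])
      (use dets in \<open>simp_all add: continuous_on_det\<close>)
  then obtain g where "path g" "path_image g \<subseteq> {-1, 1 :: real}"
      "pathstart g = det A" "pathfinish g = det B"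
    by (auto simp: path_component_def)
  moreover from this have "connected (path_image g)" "finite (path_image g)"
    by (auto intro: connected_path_image finite_subset)
  ultimately show ?thesis
    using connected_finite_iff_sing[of "path_image g"] pathstart_in_path_image[of g]
      pathfinish_in_path_image[of g] by auto
qed

text \<open>If \<open>A x \<noteq> x\<close>, the reflection exchanging \<open>A x\<close> and \<open>x\<close> fixes every fixed point
  of \<open>A\<close>, so composing with it enlarges the fixed space.\<close>

lemma orthogonal_group_components:
  fixes A :: "real^'n^'n"
  assumes n: "CARD('n) \<ge> 2" and e: "norm e = 1"
    and "A \<in> orthogonal_group"
  shows "path_component orthogonal_group A (mat 1) \<or>
    path_component orthogonal_group A (reflection e)"
  using assms(3)
\<comment> \<open>The induction is on the codimension of the fixed space.\<close>
proof (induction "CARD('n) - dim {x. A *v x = x}" arbitrary: A rule: less_induct)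
  case less
  show ?case
  proof (cases "\<forall>x. A *v x = x")
    case True
    then have "A = mat 1" by (simp add: matrix_eq)
    then show ?thesis by (simp add: path_component_refl)
  next
    case False
    then obtain x where x: "A *v x \<noteq> x" by blast
    have inner_A: "(A *v y) \<bullet> (A *v z) = y \<bullet> z" for y z
    proof -
      have "transpose A ** A = mat 1"
        using less.prems by (simp add: matrix_left_right_inverse)
      then have *: "(A *v z) v* A = z"
        by (simp only: matrix_vector_mul_assoc matrix_vector_mul_lid flip: transpose_matrix_vector)
      have "(A *v y) \<bullet> (A *v z) = (A *v z) \<bullet> (A *v y)"
        by (rule inner_commute)
      also have "\<dots> = ((A *v z) v* A) \<bullet> y"
        by (rule dot_lmul_matrix[symmetric])
      finally show ?thesis
        by (simp only: * inner_commute)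
    qed
    define w where "w = A *v x - x"
    define u where "u = w /\<^sub>R norm w"
    have w: "w \<noteq> 0" using x by (simp add: w_def)
    then have u: "norm u = 1" by (simp add: u_def)
    have refl_u: "reflection u *v y = y - (2 * (w \<bullet> y) / (w \<bullet> w)) *\<^sub>R w" for y
      by (simp add: reflection_mult_vec u_def dot_square_norm power2_eq_square divide_simps)
    define A' where "A' = reflection u ** A"
    have A': "A' \<in> orthogonal_group"
      using less.prems reflection_orthogonal[OF u] orthogonal_group_mult by (simp add: A'_def)
    \<comment> \<open>Since \<open>A\<close> preserves the norm of \<open>x\<close>, this makes the
      reflection along \<open>w\<close> send \<open>A *v x\<close> back to \<open>x\<close>.\<close>
    have "2 * (w \<bullet> (A *v x)) = w \<bullet> w"
      using inner_A[of x x] by (simp add: w_def algebra_simps inner_commute)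
    then have "A' *v x = x"
      using w by (simp add: A'_def refl_u w_def flip: matrix_vector_mul_assoc)
    moreover have "A' *v y = y" if "A *v y = y" for y
    proof -
      have "w \<bullet> y = 0"
        using inner_A[of x y] that by (simp add: w_def inner_diff_left)
      then show ?thesis
        using that by (simp add: A'_def refl_u flip: matrix_vector_mul_assoc)
    qed
    ultimately have "{y. A *v y = y} \<subset> {y. A' *v y = y}"
      using x by blast
    moreover have sub: "subspace {y. M *v y = y}" for M :: "real^'n^'n"
      by (auto simp: subspace_def matrix_vector_right_distrib matrix_vector_mult_scaleR)
    ultimately have "dim {y. A *v y = y} < dim {y. A' *v y = y}"
      by (intro dim_psubset) (simp only: span_eq_iff[THEN iffD2] sub)
    moreover have "dim {y. A' *v y = y} \<le> CARD('n)"
      using dim_subset_UNIV[of "{y. A' *v y = y}"] by simp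
    ultimately have "CARD('n) - dim {y. A' *v y = y} < CARD('n) - dim {y. A *v y = y}"
      by linarith
    from less.hyps[OF this A'] have "path_component orthogonal_group A' (mat 1) \<or>
        path_component orthogonal_group A' (reflection e)" .
    \<comment> \<open>Multiplying back by \<open>reflection u\<close> exchanges the two
      alternatives: the identity becomes \<open>reflection u\<close>, joined to
      \<open>reflection e\<close>, and \<open>reflection e\<close> becomes a product joined to
      \<open>reflection u ** reflection u\<close>, the identity.\<close>
    then have "path_component orthogonal_group (reflection u ** A') (reflection u ** mat 1) \<or>
        path_component orthogonal_group (reflection u ** A') (reflection u ** reflection e)"
      using path_component_orthogonal_group_mult reflection_orthogonal[OF u] by blast
    moreover have "reflection u ** A' = A"
      by (simp add: A'_def matrix_mul_assoc reflection_involution[OF u])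
    moreover have "path_component orthogonal_group (reflection u ** reflection e) (mat 1)"
      using path_component_orthogonal_group_mult[OF path_component_reflections[OF n e u]
          reflection_orthogonal[OF u]] by (simp add: reflection_involution[OF u])
    moreover have "path_component orthogonal_group (reflection u) (reflection e)"
      by (rule path_component_reflections[OF n u e])
    ultimately show ?thesis
      using path_component_trans[of orthogonal_group A "reflection u" "reflection e"]
        path_component_trans[of orthogonal_group A "reflection u ** reflection e" "mat 1"]
      by (elim disjE) (simp_all only: matrix_mul_rid simp_thms)
  qed
qed

text \<open>Of the two alternatives in the orthogonal group the determinant excludes the reflection.
  The path to the identity stays in \<open>SO\<close> because the determinant is constant on path
  components.\<close>

lemma path_component_SO:
  fixes A :: "real^'n^'n"
  assumes n: "CARD('n) \<ge> 2" and A: "A \<in> carrier SO"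
  shows "path_component (carrier SO) (mat 1) A"
proof -
  define e :: "real^'n" where "e = axis undefined 1"
  have "A \<in> orthogonal_group" "det A = 1"
    using A by (simp_all add: SO_simps)
  moreover have "det (reflection e) = - 1"
    unfolding e_def by (rule det_reflection_axis)
  ultimately have "\<not> path_component orthogonal_group A (reflection e)"
    using path_component_orthogonal_group_det[of A "reflection e"] by linarith
  moreover have "norm e = 1" by (simp add: e_def)
  ultimately have "path_component orthogonal_group (mat 1) A"
    using orthogonal_group_components[OF n _ \<open>A \<in> orthogonal_group\<close>, of e]
    by (simp add: path_component_sym)
  then have "A \<in> path_component_set (path_component_set orthogonal_group (mat 1)) (mat 1)"
    by (simp only: path_component_path_component mem_Collect_eq)
  then have "path_component (path_component_set orthogonal_group (mat 1)) (mat 1) A"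
    by (rule CollectD)
  moreover have "path_component_set orthogonal_group (mat 1 :: real^'n^'n) \<subseteq> carrier SO"
  proof
    fix B :: "real^'n^'n" assume "B \<in> path_component_set orthogonal_group (mat 1)"
    then have "path_component orthogonal_group (mat 1) B" by simp
    from path_component_orthogonal_group_det[OF this] path_component_mem(2)[OF this]
    show "B \<in> carrier SO" by (simp add: SO_simps)
  qed
  ultimately show ?thesis
    by (rule path_component_of_subset[rotated])
qed


section \<open>Parity of the dimension and the contradiction\<close>

text \<open>Writing the size as \<open>4 * m + r\<close> shows that twice the dimension is congruent
  to \<open>r * (r - 1)\<close>, that is to 2, modulo 4.\<close>

lemma odd_dim_skew:
  assumes "CARD('n::finite) mod 4 = 2 \<or> CARD('n) mod 4 = 3"
  shows "odd (dim (skew :: (real^'n^'n) set))"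
proof
  assume "even (dim (skew :: (real^'n^'n) set))"
  then obtain k where "dim (skew :: (real^'n^'n) set) = 2 * k" by blast
  then have k: "4 * k = CARD('n) * (CARD('n) - 1)"
    using two_times_dim_skew[where 'n='n] by simp
  obtain m r where m: "CARD('n) = 4 * m + r" "r = 2 \<or> r = 3"
    using assms mult_div_mod_eq[of 4 "CARD('n)"] by metis
  have "CARD('n) * (CARD('n) - 1) = 4 * (4 * m * m + (2 * r - 1) * m) + r * (r - 1)"
    using m(2) unfolding m(1) by (auto simp: algebra_simps)
  then have "(r * (r - 1)) mod 4 = 0"
    using k by presburger
  then show False using m(2) by auto
qed

text \<open>The defining equation is used at \<open>f x\<close>, whose preimage is \<open>x\<close>;
  the group inverse is the transpose.\<close>

lemma inverse_ambiguous_SO_square: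
  fixes f :: "real^'n^'n \<Rightarrow> real^'n^'n"
  assumes "inverse_ambiguous SO f" and x: "x \<in> carrier SO"
  shows "f x \<in> carrier SO" "f (f x) = transpose x"
proof -
  have bij: "bij_betw f (carrier SO) (carrier SO)"
    and inv: "\<And>x. x \<in> carrier SO \<Longrightarrow> inv_into (carrier SO) f x = inv\<^bsub>SO\<^esub> (f x)"
    using assms(1) by (auto simp: inverse_ambiguous_def)
  show fx: "f x \<in> carrier SO"
    using bij x by (rule bij_betwE[THEN bspec])
  have "inv_into (carrier SO) f (f x) = x"
    using bij x by (rule bij_betw_inv_into_left)
  then have "transpose (f (f x)) = x"
    using inv[OF fx] inv_SO[OF bij_betwE[OF bij, THEN bspec, OF fx]] by simp
  then show "f (f x) = transpose x" by (metis transpose_transpose)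
qed

lemma SO_mult: "A \<in> carrier SO \<Longrightarrow> B \<in> carrier SO \<Longrightarrow> A ** B \<in> carrier SO"
  using monoid.m_closed[OF group.is_monoid[OF group_SO]] by (simp only: SO_simps(2))

theorem theorem5p8:
  assumes "CARD('n::finite) mod 4 = 2 \<or> CARD('n) mod 4 = 3"
  shows "\<not> (\<exists>f :: real^'n^'n \<Rightarrow> real^'n^'n.
    continuous_on (carrier SO) f \<and> inverse_ambiguous SO f)"
proof
  let ?G = "carrier SO :: (real^'n^'n) set"
  assume "\<exists>f :: real^'n^'n \<Rightarrow> real^'n^'n. continuous_on (carrier SO) f \<and> inverse_ambiguous SO f"
  then obtain f :: "real^'n^'n \<Rightarrow> real^'n^'n"
    where cont: "continuous_on ?G f" and ia: "inverse_ambiguous SO f" by blast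
  note fG = inverse_ambiguous_SO_square(1)[OF ia] and ff = inverse_ambiguous_SO_square(2)[OF ia]
  have inj: "f x = f y \<longleftrightarrow> x = y" if "x \<in> ?G" "y \<in> ?G" for x y
    using ff[OF that(1)] ff[OF that(2)] by (metis transpose_transpose)
  have one: "mat 1 \<in> ?G" by (simp add: SO_simps)
  \<comment> \<open>As the identity is its own inverse, \<open>f\<close> exchanges it with
    \<open>a\<close>; a path from the identity to \<open>a\<close> links the two local pictures of
    \<open>f\<close>.\<close>
  define a where "a = f (mat 1)"
  have a: "a \<in> ?G" "f a = mat 1"
    using fG[OF one] ff[OF one] by (simp_all add: a_def)
  have n: "CARD('n) \<ge> 2"
    using assms mod_less[of "CARD('n)" 4] by (cases "CARD('n) < 2") auto
  obtain \<gamma> where \<gamma>: "path \<gamma>" "path_image \<gamma> \<subseteq> ?G" "pathstart \<gamma> = mat 1" "pathfinish \<gamma> = a"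
    using path_component_SO[OF n a(1)] by (auto simp: path_component_def)
  have \<gamma>G: "\<gamma> t \<in> ?G" if "t \<in> {0..1}" for t
    using \<gamma>(2) that by (auto simp: path_image_def)
  have \<gamma>01: "\<gamma> 0 = mat 1" "\<gamma> 1 = a"
    using \<gamma>(3,4) by (simp_all add: pathstart_def pathfinish_def)
  \<comment> \<open>This is \<open>f\<close> near \<open>\<gamma> t\<close>, with source and target
    translated to the identity and the source read in the Cayley chart. At \<open>t = 0\<close> it
    describes \<open>f\<close> from the identity to \<open>a\<close>, at \<open>t = 1\<close> from
    \<open>a\<close> back to the identity.\<close>
  define \<psi> where "\<psi> = (\<lambda>t v. transpose (f (\<gamma> t)) ** f (\<gamma> t ** cayley v))"
  have cay: "cayley v \<in> ?G" if "v \<in> skew" for v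
    using cayley_skew(1)[OF that] .
  have \<psi>G: "\<psi> t v \<in> ?G" if "t \<in> {0..1}" "v \<in> skew" for t v
    unfolding \<psi>_def
    by (intro SO_mult transpose_in_SO(1) fG \<gamma>G cay that)
  have \<psi>_eq_1: "\<psi> t v = mat 1 \<longleftrightarrow> v = 0" if t: "t \<in> {0..1}" and v: "v \<in> skew" for t v
  proof -
    have cancel: "X ** (transpose X ** Y) = Y" "transpose X ** X = mat 1" if "X \<in> ?G" for X Y
      using that transpose_in_SO(2)[OF that] by (simp_all add: SO_simps matrix_mul_assoc)
    have "\<psi> t v = mat 1 \<longleftrightarrow> f (\<gamma> t ** cayley v) = f (\<gamma> t)"
      using cancel[OF fG[OF \<gamma>G[OF t]]] unfolding \<psi>_def by (metis matrix_mul_rid)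
    also have "\<dots> \<longleftrightarrow> \<gamma> t ** cayley v = \<gamma> t"
      by (intro inj SO_mult \<gamma>G cay t v)
    also have "\<dots> \<longleftrightarrow> cayley v = mat 1"
      using cancel[OF \<gamma>G[OF t]] transpose_in_SO(2)[OF \<gamma>G[OF t]]
      by (metis matrix_mul_rid matrix_mul_assoc matrix_mul_lid)
    also have "\<dots> \<longleftrightarrow> v = 0"
      by (rule cayley_eq_1_iff[OF det_one_plus_skew[OF v]])
    finally show ?thesis .
  qed
  have cont\<gamma>: "continuous_on {0..1} \<gamma>"
    using \<gamma>(1) by (simp add: path_def)
  have cont\<psi>: "continuous_on ({0..1} \<times> skew) (\<lambda>z. \<psi> (fst z) (snd z))"
  proof -
    have 1: "continuous_on ({0..1} \<times> skew) (\<lambda>z. \<gamma> (fst z))"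
      by (rule continuous_on_compose2[OF cont\<gamma>]) (auto intro: continuous_intros)
    have 2: "continuous_on ({0..1::real} \<times> skew) (\<lambda>z. cayley (snd z))"
      by (intro continuous_on_cayley continuous_intros) (auto simp: det_one_plus_skew)
    have 3: "continuous_on ({0..1} \<times> skew) (\<lambda>z. f (\<gamma> (fst z)))"
      by (rule continuous_on_compose2[OF cont 1]) (auto simp: \<gamma>G)
    have 4: "continuous_on ({0..1} \<times> skew) (\<lambda>z. f (\<gamma> (fst z) ** cayley (snd z)))"
      by (rule continuous_on_compose2[OF cont matrix_mult.continuous_on[OF 1 2]])
        (auto intro!: SO_mult \<gamma>G cay)
    show ?thesis
      unfolding \<psi>_def by (intro matrix_mult.continuous_on continuous_on_transpose 3 4)
  qed
  \<comment> \<open>The target can be read in the Cayley chart only where this determinant is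
    nonzero. Compactness of the parameter interval and of the unit ball in \<open>skew\<close> gives
    one radius for all \<open>t\<close>.\<close>
  obtain R where R: "R > 0"
    "\<And>t v. \<lbrakk>t \<in> {0..1}; v \<in> skew; norm v \<le> R\<rbrakk> \<Longrightarrow> det (mat 1 + \<psi> t v) \<noteq> 0"
  proof -
    let ?K = "{0..1::real} \<times> (cball 0 1 \<inter> (skew :: (real^'n^'n) set))"
    let ?d = "\<lambda>z. det (mat 1 + \<psi> (fst z) (snd z))"
    have "compact ?K"
      by (intro compact_Times compact_Icc compact_Int_closed compact_cball
          closed_subspace subspace_skew)
    moreover have "continuous_on ?K ?d"
      by (intro continuous_on_det continuous_intros continuous_on_subset[OF cont\<psi>]) auto
    ultimately have unif: "uniformly_continuous_on ?K ?d"
      by (intro compact_uniformly_continuous)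
    have d0: "?d (t, 0) = det (mat 1 + mat 1 :: real^'n^'n)" if "t \<in> {0..1}" for t
      using \<psi>_eq_1[OF that subspace_0[OF subspace_skew]] by simp
    \<comment> \<open>At \<open>v = 0\<close> the map \<open>\<psi> t\<close> takes the identity as
      its value, so \<open>\<epsilon>\<close> is the size of the determinant there; values closer
      than this to it cannot vanish.\<close>
    define \<epsilon> where "\<epsilon> = \<bar>det (mat 1 + mat 1 :: real^'n^'n)\<bar>"
    have "cayley 0 = (mat 1 :: real^'n^'n)"
      using cayley_eq_1_iff[of "0 :: real^'n^'n"] by simp
    then have "\<epsilon> > 0"
      using det_one_plus_cayley[of "0 :: real^'n^'n"] by (simp add: \<epsilon>_def)
    then obtain \<delta> where \<delta>: "\<delta> > 0"
      "\<And>x y. \<lbrakk>x \<in> ?K; y \<in> ?K; dist x y < \<delta>\<rbrakk> \<Longrightarrow> dist (?d x) (?d y) < \<epsilon>"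
      using unif unfolding uniformly_continuous_on_def by metis
    show thesis
    proof (rule that[of "min 1 (\<delta> / 2)"])
      fix t :: real and v :: "real^'n^'n"
      assume tv: "t \<in> {0..1}" "v \<in> skew" "norm v \<le> min 1 (\<delta> / 2)"
      have "dist (?d (t, v)) (?d (t, 0)) < \<epsilon>"
        using tv \<delta>(1) subspace_0[OF subspace_skew]
        by (intro \<delta>(2)) (auto simp: dist_Pair_Pair)
      then show "det (mat 1 + \<psi> t v) \<noteq> 0"
        unfolding d0[OF tv(1)] by (auto simp: \<epsilon>_def dist_real_def)
    qed (use \<delta>(1) in auto)
  qed
  show False
  proof (rule no_local_square_root_of_uminus[OF subspace_skew odd_dim_skew[OF assms] R(1),
        where \<Phi>="\<lambda>t v. cayley (\<psi> t v)"])
    show "continuous_on ({0..1} \<times> (cball 0 R \<inter> skew)) (\<lambda>(t, v). cayley (\<psi> t v))"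
      unfolding case_prod_beta
      by (intro continuous_on_cayley continuous_on_subset[OF cont\<psi>]) (use R(2) in auto)
    fix t :: real and v :: "real^'n^'n"
    assume tv: "t \<in> {0..1}" "v \<in> skew" "norm v \<le> R"
    show "cayley (\<psi> t v) \<in> skew"
      by (intro cayley_SO \<psi>G R(2) tv)
    \<comment> \<open>The involution exchanges \<open>0\<close> and the identity.\<close>
    have "cayley (\<psi> t v) = 0 \<longleftrightarrow> \<psi> t v = mat 1"
      using cayley_cayley[OF R(2)[OF tv]] cayley_1 cayley_eq_1_iff[of "0 :: real^'n^'n"]
      by (metis add.right_neutral det_I zero_neq_one)
    then show "cayley (\<psi> t v) = 0 \<longleftrightarrow> v = 0"
      using \<psi>_eq_1[OF tv(1,2)] by simp
  next
    fix v :: "real^'n^'n" assume v: "v \<in> skew" "norm v \<le> R" "norm (cayley (\<psi> 0 v)) \<le> R"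
    have \<psi>0: "\<psi> 0 v = transpose a ** f (cayley v)"
      by (simp add: \<psi>_def \<gamma>01 a_def)
    \<comment> \<open>The target chart of \<open>\<psi> 0\<close> and the source chart of
      \<open>\<psi> 1\<close> are both centred at \<open>a\<close> and cancel. What remains is
      \<open>f\<close> applied twice to \<open>cayley v\<close>, hence its transpose, which the
      chart reads as \<open>- v\<close>.\<close>
    have "a ** cayley (cayley (\<psi> 0 v)) = f (cayley v)"
      using cayley_cayley[OF R(2)[of 0 v]] v a(1)
      by (simp add: \<psi>0 matrix_mul_assoc SO_simps)
    then have "\<psi> 1 (cayley (\<psi> 0 v)) = transpose (cayley v)"
      using a(2) ff[OF cay[OF v(1)]] by (simp add: \<psi>_def \<gamma>01)
    then have "\<psi> 1 (cayley (\<psi> 0 v)) = cayley (- v)"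
      using cayley_skew(2)[OF v(1)] by simp
    then show "cayley (\<psi> 1 (cayley (\<psi> 0 v))) = - v"
      using cayley_cayley[OF det_one_plus_skew[OF subspace_neg[OF subspace_skew v(1)]]] by simp
  qed
qed

end
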